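(* Let $H$ be the generalized orthocenter of the point $P$ with respect to $ABC$, and assume $H\neq A,B,C$. The point $Q^2=\gamma_P(G)$ is the isotomcomplement of $H$; that is, $\gamma_P(G)=Q^2=K\circ\iota(H)$.
   Context: We work in the Euclidean plane extended by its line at infinity $l_\infty$; affine maps are extended to $l_\infty$. $ABC$ is an ordinary non-degenerate triangle with centroid $G$; its sides are the lines $BC, CA, AB$. $X_1X_2\cdot Y_1Y_2$ denotes the intersection of two lines. $K$ is the complement map (homothety with center $G$ and ratio $-1/2$); $K^{-1}(ABC)$ is the anticomplementary triangle. $\iota$ is the isotomic map, $(x:y:z)\mapsto(1/x:1/y:1/z)$ in barycentric coordinates. The isotomcomplement of a point $R$ is $K\circ\iota(R)$. $P$ is a point not on the sides of $ABC$ or $K^{-1}(ABC)$; $P'=\iota(P)$, $Q=K(P')$, and $D=AP\cdot BC$, $E=BP\cdot CA$, $F=CP\cdot AB$. The generalized orthocenter $H$ of $P$ is the common point of the lines through $A,B,C$ parallel, respectively, to $QD,QE,QF$ (if $Q\in l_\infty$, then $H=Q$). $Q^2$ denotes the point whose barycentric coordinates with respect to $ABC$ are the squares of those of $Q$. Generalized isogonal map $\gamma_P$: let $h_a$ be the affine reflection about the line $AQ$ in the direction of $EF$ (i.e. $h_a(X)=X'$ with $XX'\parallel EF$ and the midpoint of $XX'$ on $AQ$), $h_b$ the affine reflection about $BQ$ in the direction $DF$, and $h_c$ the affine reflection about $CQ$ in the direction $DE$. For $X\neq A,B,C$, $\gamma_P(X)$ is the common point of the lines $Ah_a(X),Bh_b(X),Ch_c(X)$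 (which are concurrent). *)

theory Defs
  imports "HOL-Analysis.Analysis"
begin

section \<open>The Euclidean plane extended by its line at infinity\<close>

text \<open>
  The plane \<open>real^2\<close> is embedded as the affine plane \<open>w = 1\<close> of \<open>real^2 \<times> real\<close>; a point of the
  extended plane is a one-dimensional subspace of \<open>real^2 \<times> real\<close>, and the points at infinity are
  those contained in the plane \<open>w = 0\<close>.
\<close>

typedef epoint = "{S :: ((real^2) \<times> real) set. \<exists>u. u \<noteq> 0 \<and> S = span {u}}"
  morphisms subspace_of Abs_epoint
proof -
  have "(0, 1) \<noteq> (0 :: (real^2) \<times> real)" by (simp add: prod_eq_iff)
  then show ?thesis by blast
qed

text \<open>The point with homogeneous coordinates \<open>u\<close>; unspecified for \<open>u = 0\<close>.\<close>

definition hpoint :: "(real^2) \<times> real \<Rightarrow> epoint" where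
  "hpoint u = Abs_epoint (span {u})"

definition pt :: "real^2 \<Rightarrow> epoint" where
  "pt X = hpoint (X, 1)"

definition linf :: "epoint set" where
  "linf = {Z. subspace_of Z \<subseteq> UNIV \<times> {0}}"

definition ln_through :: "epoint \<Rightarrow> epoint \<Rightarrow> epoint set" where
  "ln_through X Y = {Z. subspace_of Z \<subseteq> span (subspace_of X \<union> subspace_of Y)}"

definition meet :: "epoint set \<Rightarrow> epoint set \<Rightarrow> epoint" where
  "meet l m = (THE Z. Z \<in> l \<and> Z \<in> m)"

text \<open>The line through \<open>X\<close> parallel to \<open>l\<close> (equal to \<open>l\<close> if \<open>X\<close> lies on \<open>l\<close>).\<close>

definition par_through :: "epoint \<Rightarrow> epoint set \<Rightarrow> epoint set" where
  "par_through X l = ln_through X (meet l linf)"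

text \<open>
  Extension of an affine bijection \<open>f\<close> of \<open>real^2\<close>: if \<open>f x = L x + f 0\<close> with \<open>L\<close> linear, then the
  point with homogeneous coordinates \<open>(v, w)\<close> is sent to \<open>(L v + w f(0), w)\<close>.
\<close>

definition ext_affine :: "(real^2 \<Rightarrow> real^2) \<Rightarrow> epoint \<Rightarrow> epoint" where
  "ext_affine f X =
     Abs_epoint ((\<lambda>(v, w). ((f v - f 0) + w *\<^sub>R f 0, w)) ` subspace_of X)"


section \<open>Barycentric coordinates, complement and isotomic map\<close>

text \<open>
  The point \<open>(x : y : z)\<close> with respect to \<open>ABC\<close>: the affine combination
  \<open>(x A + y B + z C) / (x + y + z)\<close> if \<open>x + y + z \<noteq> 0\<close>, and the point at infinity in the direction
  \<open>x A + y B + z C\<close> otherwise.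
\<close>

definition bary :: "real^2 \<Rightarrow> real^2 \<Rightarrow> real^2 \<Rightarrow> real \<Rightarrow> real \<Rightarrow> real \<Rightarrow> epoint" where
  "bary A B C x y z = hpoint (x *\<^sub>R A + y *\<^sub>R B + z *\<^sub>R C, x + y + z)"

definition centroid :: "real^2 \<Rightarrow> real^2 \<Rightarrow> real^2 \<Rightarrow> real^2" where
  "centroid A B C = (1/3) *\<^sub>R (A + B + C)"

definition complement_map :: "real^2 \<Rightarrow> real^2 \<Rightarrow> real^2 \<Rightarrow> real^2 \<Rightarrow> real^2" where
  "complement_map A B C X = centroid A B C + (-1/2) *\<^sub>R (X - centroid A B C)"

definition complement :: "real^2 \<Rightarrow> real^2 \<Rightarrow> real^2 \<Rightarrow> epoint \<Rightarrow> epoint" where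
  "complement A B C = ext_affine (complement_map A B C)"

text \<open>Only meaningful for points that are not on the sides of \<open>ABC\<close>.\<close>

definition isotomic :: "real^2 \<Rightarrow> real^2 \<Rightarrow> real^2 \<Rightarrow> epoint \<Rightarrow> epoint" where
  "isotomic A B C X =
     (THE Y. \<exists>x y z. x \<noteq> 0 \<and> y \<noteq> 0 \<and> z \<noteq> 0 \<and> X = bary A B C x y z \<and>
                     Y = bary A B C (1/x) (1/y) (1/z))"

definition isotomcomplement :: "real^2 \<Rightarrow> real^2 \<Rightarrow> real^2 \<Rightarrow> epoint \<Rightarrow> epoint" where
  "isotomcomplement A B C = complement A B C \<circ> isotomic A B C"

definition bary_square :: "real^2 \<Rightarrow> real^2 \<Rightarrow> real^2 \<Rightarrow> epoint \<Rightarrow> epoint" where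
  "bary_square A B C X =
     (THE Y. \<exists>x y z. (x, y, z) \<noteq> (0, 0, 0) \<and> X = bary A B C x y z \<and>
                     Y = bary A B C (x^2) (y^2) (z^2))"

definition sides :: "real^2 \<Rightarrow> real^2 \<Rightarrow> real^2 \<Rightarrow> epoint set" where
  "sides A B C =
     ln_through (pt B) (pt C) \<union> ln_through (pt C) (pt A) \<union> ln_through (pt A) (pt B)"

definition anticomplementary_sides :: "real^2 \<Rightarrow> real^2 \<Rightarrow> real^2 \<Rightarrow> epoint set" where
  "anticomplementary_sides A B C =
     (let K' = inv (complement_map A B C) in sides (K' A) (K' B) (K' C))"


section \<open>Points and maps associated with \<open>P\<close>\<close>

definition Q_pt :: "real^2 \<Rightarrow> real^2 \<Rightarrow> real^2 \<Rightarrow> epoint \<Rightarrow> epoint" where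
  "Q_pt A B C P = complement A B C (isotomic A B C P)"

definition D_pt :: "real^2 \<Rightarrow> real^2 \<Rightarrow> real^2 \<Rightarrow> epoint \<Rightarrow> epoint" where
  "D_pt A B C P = meet (ln_through (pt A) P) (ln_through (pt B) (pt C))"

definition E_pt :: "real^2 \<Rightarrow> real^2 \<Rightarrow> real^2 \<Rightarrow> epoint \<Rightarrow> epoint" where
  "E_pt A B C P = meet (ln_through (pt B) P) (ln_through (pt C) (pt A))"

definition F_pt :: "real^2 \<Rightarrow> real^2 \<Rightarrow> real^2 \<Rightarrow> epoint \<Rightarrow> epoint" where
  "F_pt A B C P = meet (ln_through (pt C) P) (ln_through (pt A) (pt B))"

definition gen_orthocenter :: "real^2 \<Rightarrow> real^2 \<Rightarrow> real^2 \<Rightarrow> epoint \<Rightarrow> epoint" where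
  "gen_orthocenter A B C P =
     (let Q = Q_pt A B C P in
      if Q \<in> linf then Q
      else (THE H. H \<in> par_through (pt A) (ln_through Q (D_pt A B C P)) \<and>
                   H \<in> par_through (pt B) (ln_through Q (E_pt A B C P)) \<and>
                   H \<in> par_through (pt C) (ln_through Q (F_pt A B C P))))"

text \<open>
  The affine reflection about the line \<open>l\<close> in the direction of the line \<open>m\<close>. The condition
  \<open>XY \<parallel> m\<close> is stated as \<open>Y\<close> lying on the parallel to \<open>m\<close> through \<open>X\<close>, so that it makes sense
  also for \<open>Y = X\<close>, which is the image of \<open>X\<close> if \<open>X\<close> lies on \<open>l\<close>.
\<close>

definition aff_reflection :: "epoint set \<Rightarrow> epoint set \<Rightarrow> real^2 \<Rightarrow> real^2" where
  "aff_reflection l m X =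
     (THE Y. pt Y \<in> par_through (pt X) m \<and> pt (midpoint X Y) \<in> l)"

definition gen_isogonal :: "real^2 \<Rightarrow> real^2 \<Rightarrow> real^2 \<Rightarrow> epoint \<Rightarrow> epoint \<Rightarrow> epoint" where
  "gen_isogonal A B C P X =
     (let Q = Q_pt A B C P; D = D_pt A B C P; E = E_pt A B C P; F = F_pt A B C P;
          ha = ext_affine (aff_reflection (ln_through (pt A) Q) (ln_through E F));
          hb = ext_affine (aff_reflection (ln_through (pt B) Q) (ln_through D F));
          hc = ext_affine (aff_reflection (ln_through (pt C) Q) (ln_through D E))
      in (THE Y. Y \<in> ln_through (pt A) (ha X) \<and>
                 Y \<in> ln_through (pt B) (hb X) \<and>
                 Y \<in> ln_through (pt C) (hc X)))"

end

theory Submission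
  imports Defs
begin

text \<open>
  The proof computes in homogeneous barycentric coordinates.  Since \<open>ABC\<close> is non-degenerate, they
  make the extended plane the projective plane over \<open>\<real>\<close>: a line is the kernel of a linear form, joins
  and meets are cross products (\<open>ln_through_points\<close>, \<open>meet_lines\<close>), the line at infinity is
  \<open>x + y + z = 0\<close>, and affine maps act linearly (\<open>ext_affine_point\<close>).

  Let \<open>P = (p : q : r)\<close> and \<open>\<sigma> = pq + qr + rp\<close>.  Then \<open>Q = (u : v : w)\<close> with \<open>u = p(q + r)\<close>,
  \<open>v = q(r + p)\<close>, \<open>w = r(p + q)\<close>, and these are nonzero because \<open>P\<close> lies neither on a side of \<open>ABC\<close>
  nor on a side of its anticomplementary triangle.

  The point at infinity of \<open>EF\<close> has coordinates \<open>(\<dots> : v : -w)\<close>, while \<open>AQ\<close> is the line \<open>w y = v z\<close>.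
  So on the pencil of lines through \<open>A\<close> the reflection \<open>h\<^sub>a\<close> exchanges \<open>y/v\<close> and \<open>z/w\<close>, and it sends the
  centroid \<open>(1 : 1 : 1)\<close> to a point with \<open>y : z = v/w : w/v = v\<^sup>2 : w\<^sup>2\<close>.  The same holds at \<open>B\<close> and \<open>C\<close>,
  so the three lines meet in \<open>(u\<^sup>2 : v\<^sup>2 : w\<^sup>2)\<close> (\<open>gen_isogonal_centroid\<close>).

  The parallel through \<open>A\<close> to \<open>QD\<close> is \<open>y : z = q(\<sigma> - r\<^sup>2) : r(\<sigma> - q\<^sup>2)\<close>, and similarly at \<open>B\<close> and \<open>C\<close>.
  Hence \<open>H\<close> is, up to a common factor, \<open>(p/(\<sigma> - p\<^sup>2) : q/(\<sigma> - q\<^sup>2) : r/(\<sigma> - r\<^sup>2))\<close>; this also gives \<open>Q\<close>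
  when \<open>\<sigma> = 0\<close>, that is, when \<open>Q\<close> is at infinity (\<open>gen_orthocenter_eq\<close>).  A denominator vanishes exactly
  when \<open>H\<close> is the corresponding vertex.  Otherwise the first coordinate of the complement of the
  isotomic image of \<open>H\<close> is \<open>(\<sigma> - q\<^sup>2)/q + (\<sigma> - r\<^sup>2)/r = (q + r)(\<sigma> - qr)/(qr)\<close>, which is
  \<open>p(q + r)\<^sup>2/(qr) = u\<^sup>2/(pqr)\<close>; by symmetry the result is again \<open>(u\<^sup>2 : v\<^sup>2 : w\<^sup>2)\<close>
  (\<open>isotomcomplement_orthocenter\<close>).
\<close>

section \<open>Points of the extended plane by homogeneous vectors\<close>

lemma subspace_of_hpoint: "u \<noteq> 0 \<Longrightarrow> subspace_of (hpoint u) = span {u}"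
  unfolding hpoint_def by (subst Abs_epoint_inverse) blast+

lemma epoint_hpoint:
  obtains u where "u \<noteq> 0" "X = hpoint u"
proof -
  obtain u where "u \<noteq> 0" "subspace_of X = span {u}"
    using subspace_of[of X] by blast
  then have "X = hpoint u"
    unfolding hpoint_def by (metis subspace_of_inverse)
  with \<open>u \<noteq> 0\<close> show thesis by (rule that)
qed

lemma hpoint_subset_iff:
  assumes "u \<noteq> 0" and "subspace S"
  shows "subspace_of (hpoint u) \<subseteq> S \<longleftrightarrow> u \<in> S"
proof
  assume "subspace_of (hpoint u) \<subseteq> S"
  then show "u \<in> S"
    by (metis assms(1) insertI1 span_base subsetD subspace_of_hpoint)
next
  assume "u \<in> S"
  then show "subspace_of (hpoint u) \<subseteq> S"
    using assms by (simp add: subspace_of_hpoint span_minimal)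
qed

lemma hpoint_on_line_iff:
  assumes "u \<noteq> 0" "a \<noteq> 0" "b \<noteq> 0"
  shows "hpoint u \<in> ln_through (hpoint a) (hpoint b) \<longleftrightarrow> (\<exists>s t. u = s *\<^sub>R a + t *\<^sub>R b)"
proof -
  have "hpoint u \<in> ln_through (hpoint a) (hpoint b) \<longleftrightarrow> u \<in> span (span {a} \<union> span {b})"
    unfolding ln_through_def mem_Collect_eq using assms
    by (subst hpoint_subset_iff) (simp_all add: subspace_of_hpoint)
  also have "span (span {a} \<union> span {b}) = {x + y |x y. x \<in> span {a} \<and> y \<in> span {b}}"
    by (simp only: span_Un span_span)
  also have "u \<in> \<dots> \<longleftrightarrow> (\<exists>s t. u = s *\<^sub>R a + t *\<^sub>R b)"
    unfolding span_singleton by blast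
  finally show ?thesis .
qed

lemma hpoint_eq_iff:
  assumes "u \<noteq> 0" "v \<noteq> 0"
  shows "hpoint u = hpoint v \<longleftrightarrow> (\<exists>k. u = k *\<^sub>R v)"
proof
  assume "hpoint u = hpoint v"
  then have "u \<in> span {v}"
    using assms by (metis insertI1 span_base subspace_of_hpoint)
  then show "\<exists>k. u = k *\<^sub>R v"
    by (auto simp: span_singleton)
next
  assume "\<exists>k. u = k *\<^sub>R v"
  then obtain k where k: "u = k *\<^sub>R v" by blast
  with assms have "k \<noteq> 0" by auto
  then have "v = (1/k) *\<^sub>R u" by (simp add: k)
  with k have "u \<in> span {v}" "v \<in> span {u}" unfolding span_singleton by blast+
  then have "span {u} = span {v}" by (simp add: span_eq)
  then show "hpoint u = hpoint v" by (simp add: hpoint_def)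
qed

section \<open>Cross products in coordinates\<close>

text \<open>The equations say that the cross product of \<open>(a, b, c)\<close> and \<open>(x, y, z)\<close> is zero; the factor is read
  off from a coordinate in which \<open>(a, b, c)\<close> does not vanish.\<close>

lemma cross_eq_0:
  fixes a b c x y z :: real
  assumes "a \<noteq> 0 \<or> b \<noteq> 0 \<or> c \<noteq> 0"
    and "b*z = c*y" "c*x = a*z" "a*y = b*x"
  obtains k where "x = k*a" "y = k*b" "z = k*c"
proof -
  consider "a \<noteq> 0" | "b \<noteq> 0" | "c \<noteq> 0" using assms(1) by blast
  then show thesis
  proof cases
    case 1 then show thesis using assms by (intro that[of "x/a"]) (simp_all add: field_simps)
  next
    case 2 then show thesis using assms by (intro that[of "y/b"]) (simp_all add: field_simps)
  next
    case 3 then show thesis using assms by (intro that[of "z/c"]) (simp_all add: field_simps)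
  qed
qed

text \<open>This gives uniqueness of the intersection of two distinct lines: both are linear forms, and only the
  multiples of their cross product are killed by both.\<close>

lemma orthogonal_both:
  fixes a1 a2 a3 b1 b2 b3 x y z :: real
  assumes n: "a2*b3 - a3*b2 \<noteq> 0 \<or> a3*b1 - a1*b3 \<noteq> 0 \<or> a1*b2 - a2*b1 \<noteq> 0"
    and a: "a1*x + a2*y + a3*z = 0" and b: "b1*x + b2*y + b3*z = 0"
  obtains k where "x = k*(a2*b3 - a3*b2)" "y = k*(a3*b1 - a1*b3)" "z = k*(a1*b2 - a2*b1)"
proof (rule cross_eq_0[OF n, of z y x])
  show "(a3*b1 - a1*b3)*z = (a1*b2 - a2*b1)*y" using a b by algebra
  show "(a1*b2 - a2*b1)*x = (a2*b3 - a3*b2)*z" using a b by algebra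
  show "(a2*b3 - a3*b2)*y = (a3*b1 - a1*b3)*x" using a b by algebra
qed (rule that)

lemma divide_lincomb:
  fixes n :: real
  assumes "n \<noteq> 0" "x * n = c*a + d*b"
  shows "x = c/n*a + d/n*b"
  using assms by (simp add: field_simps)

text \<open>The coefficients come from Cramer's rule, applied to the two coordinates whose minor \<open>?n\<close> is nonzero;
  the vanishing determinant \<open>d\<close> takes care of the remaining coordinate.\<close>

lemma in_plane_spanned:
  fixes a1 a2 a3 b1 b2 b3 x y z :: real
  assumes n: "a2*b3 - a3*b2 \<noteq> 0 \<or> a3*b1 - a1*b3 \<noteq> 0 \<or> a1*b2 - a2*b1 \<noteq> 0"
    and d: "(a2*b3 - a3*b2)*x + (a3*b1 - a1*b3)*y + (a1*b2 - a2*b1)*z = 0"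
  obtains s t where "x = s*a1 + t*b1" "y = s*a2 + t*b2" "z = s*a3 + t*b3"
proof -
  consider "a2*b3 - a3*b2 \<noteq> 0" | "a3*b1 - a1*b3 \<noteq> 0" | "a1*b2 - a2*b1 \<noteq> 0"
    using n by blast
  then show thesis
  proof cases
    case 1
    let ?n = "a2*b3 - a3*b2"
    show thesis
    proof (rule that[of "(y*b3 - z*b2)/?n" "(a2*z - a3*y)/?n"])
      have "x * ?n = (y*b3 - z*b2)*a1 + (a2*z - a3*y)*b1" using d by algebra
      then show "x = (y*b3 - z*b2)/?n*a1 + (a2*z - a3*y)/?n*b1"
        by (rule divide_lincomb[OF 1])
      have "y * ?n = (y*b3 - z*b2)*a2 + (a2*z - a3*y)*b2" by algebra
      then show "y = (y*b3 - z*b2)/?n*a2 + (a2*z - a3*y)/?n*b2"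
        by (rule divide_lincomb[OF 1])
      have "z * ?n = (y*b3 - z*b2)*a3 + (a2*z - a3*y)*b3" by algebra
      then show "z = (y*b3 - z*b2)/?n*a3 + (a2*z - a3*y)/?n*b3"
        by (rule divide_lincomb[OF 1])
    qed
  next
    case 2
    let ?n = "a3*b1 - a1*b3"
    show thesis
    proof (rule that[of "(z*b1 - x*b3)/?n" "(a3*x - a1*z)/?n"])
      have "x * ?n = (z*b1 - x*b3)*a1 + (a3*x - a1*z)*b1" by algebra
      then show "x = (z*b1 - x*b3)/?n*a1 + (a3*x - a1*z)/?n*b1"
        by (rule divide_lincomb[OF 2])
      have "y * ?n = (z*b1 - x*b3)*a2 + (a3*x - a1*z)*b2" using d by algebra
      then show "y = (z*b1 - x*b3)/?n*a2 + (a3*x - a1*z)/?n*b2"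
        by (rule divide_lincomb[OF 2])
      have "z * ?n = (z*b1 - x*b3)*a3 + (a3*x - a1*z)*b3" by algebra
      then show "z = (z*b1 - x*b3)/?n*a3 + (a3*x - a1*z)/?n*b3"
        by (rule divide_lincomb[OF 2])
    qed
  next
    case 3
    let ?n = "a1*b2 - a2*b1"
    show thesis
    proof (rule that[of "(x*b2 - y*b1)/?n" "(a1*y - a2*x)/?n"])
      have "x * ?n = (x*b2 - y*b1)*a1 + (a1*y - a2*x)*b1" by algebra
      then show "x = (x*b2 - y*b1)/?n*a1 + (a1*y - a2*x)/?n*b1"
        by (rule divide_lincomb[OF 3])
      have "y * ?n = (x*b2 - y*b1)*a2 + (a1*y - a2*x)*b2" by algebra
      then show "y = (x*b2 - y*b1)/?n*a2 + (a1*y - a2*x)/?n*b2"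
        by (rule divide_lincomb[OF 3])
      have "z * ?n = (x*b2 - y*b1)*a3 + (a1*y - a2*x)*b3" using d by algebra
      then show "z = (x*b2 - y*b1)/?n*a3 + (a1*y - a2*x)/?n*b3"
        by (rule divide_lincomb[OF 3])
    qed
  qed
qed

section \<open>The coordinate calculus of a triangle\<close>

locale triangle =
  fixes A B C :: "real^2"
  assumes nondegenerate: "\<not> collinear {A, B, C}"
begin

abbreviation point :: "real \<Rightarrow> real \<Rightarrow> real \<Rightarrow> epoint" where
  "point \<equiv> bary A B C"

definition hvec :: "real \<Rightarrow> real \<Rightarrow> real \<Rightarrow> (real^2) \<times> real" where
  "hvec x y z = (x *\<^sub>R A + y *\<^sub>R B + z *\<^sub>R C, x + y + z)"

lemma point_hvec: "point x y z = hpoint (hvec x y z)"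
  by (simp add: bary_def hvec_def)

lemma hvec_lincomb:
  "s *\<^sub>R hvec x y z + t *\<^sub>R hvec x' y' z' = hvec (s*x + t*x') (s*y + t*y') (s*z + t*z')"
  by (simp add: hvec_def algebra_simps)

lemma hvec_scale: "s *\<^sub>R hvec x y z = hvec (s*x) (s*y) (s*z)"
  using hvec_lincomb[of s x y z 0 0 0 0] by simp

lemma hvec_diff: "hvec x y z - hvec x' y' z' = hvec (x - x') (y - y') (z - z')"
  using hvec_lincomb[of 1 x y z "-1" x' y' z'] by simp

lemma hvec_eq_0_iff: "hvec x y z = 0 \<longleftrightarrow> x = 0 \<and> y = 0 \<and> z = 0"
proof
  assume "hvec x y z = 0"
  then have v: "x *\<^sub>R A + y *\<^sub>R B + z *\<^sub>R C = 0" and w: "x + y + z = 0"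
    by (simp_all add: hvec_def prod_eq_iff)
  have AC: "A \<noteq> C" using nondegenerate by (auto simp: insert_commute)
  have y: "y = 0"
  proof (rule ccontr)
    assume "y \<noteq> 0"
    have "y *\<^sub>R B = (- x) *\<^sub>R A + (- z) *\<^sub>R C"
      using v by (simp add: eq_neg_iff_add_eq_0 algebra_simps)
    then have "B = (1/y) *\<^sub>R ((- x) *\<^sub>R A + (- z) *\<^sub>R C)"
      using \<open>y \<noteq> 0\<close> by (metis divide_self_if scaleR_one scaleR_scaleR times_divide_eq_left mult_1)
    also have "\<dots> = (- x/y) *\<^sub>R A + (1 - (- x/y)) *\<^sub>R C"
    proof -
      have "- z = y + x" using w by simp
      then have "1 - (- x/y) = - z/y" using \<open>y \<noteq> 0\<close> by (simp add: add_divide_distrib)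
      then show ?thesis by (simp only: scaleR_add_right scaleR_scaleR) simp
    qed
    finally show False
      using nondegenerate unfolding collinear_3_expand by blast
  qed
  have "x = - z" using w y by simp
  then have "z *\<^sub>R (C - A) = 0" using v y by (simp add: algebra_simps)
  then have "z = 0" using AC by simp
  with y \<open>x = - z\<close> show "x = 0 \<and> y = 0 \<and> z = 0" by simp
qed (simp add: hvec_def zero_prod_def)

lemma hvec_eq_iff: "hvec x y z = hvec x' y' z' \<longleftrightarrow> x = x' \<and> y = y' \<and> z = z'"
  by (metis eq_iff_diff_eq_0 hvec_diff hvec_eq_0_iff)

text \<open>The coordinate map is an injective linear map between spaces of dimension \<open>3\<close>.  To compare
  dimensions inside one type, its domain is taken to be the plane times \<open>\<real>\<close> as well, with the two
  components of the plane vector serving as the first two coordinates.\<close>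

lemma hvec_surj:
  obtains x y z where "u = hvec x y z"
proof -
  let ?g = "\<lambda>u :: (real^2) \<times> real. hvec (fst u $ 1) (fst u $ 2) (snd u)"
  have lin: "linear ?g"
    by (rule linearI) (simp_all add: hvec_def algebra_simps)
  have "inj ?g"
    unfolding linear_injective_0[OF lin]
    unfolding hvec_eq_0_iff by (simp add: prod_eq_iff vec_eq_iff forall_2)
  then have "surj ?g"
    by (rule linear_inj_imp_surj[OF lin])
  then obtain v where "u = ?g v" by (rule surjE)
  then show thesis by (rule that)
qed

lemma point_exhaust:
  obtains x y z where "x \<noteq> 0 \<or> y \<noteq> 0 \<or> z \<noteq> 0" "X = point x y z"
proof -
  obtain u where u: "u \<noteq> 0" "X = hpoint u" by (rule epoint_hpoint)
  obtain x y z where "u = hvec x y z" by (rule hvec_surj)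
  with u show thesis
    by (intro that[of x y z]) (auto simp: point_hvec hvec_eq_0_iff)
qed

lemma plane_exhaust:
  obtains x y z where "x + y + z = 1" "X = x *\<^sub>R A + y *\<^sub>R B + z *\<^sub>R C"
proof -
  obtain x y z where "(X, 1) = hvec x y z" by (rule hvec_surj)
  then have "X = x *\<^sub>R A + y *\<^sub>R B + z *\<^sub>R C" "x + y + z = 1"
    by (simp_all only: hvec_def prod.inject)
  then show thesis by (intro that)
qed

lemma pt_point: "x + y + z = 1 \<Longrightarrow> pt (x *\<^sub>R A + y *\<^sub>R B + z *\<^sub>R C) = point x y z"
  by (simp add: pt_def bary_def)

lemma pt_vertices: "pt A = point 1 0 0" "pt B = point 0 1 0" "pt C = point 0 0 1"
  by (simp_all add: pt_def bary_def)

lemma pt_centroid: "pt (centroid A B C) = point (1/3) (1/3) (1/3)"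
  using pt_point[of "1/3" "1/3" "1/3"] by (simp add: centroid_def scaleR_add_right)

lemma point_eq_iff:
  assumes "x \<noteq> 0 \<or> y \<noteq> 0 \<or> z \<noteq> 0" "x' \<noteq> 0 \<or> y' \<noteq> 0 \<or> z' \<noteq> 0"
  shows "point x y z = point x' y' z' \<longleftrightarrow> (\<exists>k. k \<noteq> 0 \<and> x = k*x' \<and> y = k*y' \<and> z = k*z')"
proof -
  have "point x y z = point x' y' z' \<longleftrightarrow> (\<exists>k. x = k*x' \<and> y = k*y' \<and> z = k*z')"
    unfolding point_hvec using assms
    by (subst hpoint_eq_iff) (simp_all add: hvec_eq_0_iff hvec_scale hvec_eq_iff)
  moreover have "k \<noteq> 0" if "x = k*x' \<and> y = k*y' \<and> z = k*z'" for k
    using that assms(1) by auto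
  ultimately show ?thesis by blast
qed

lemma point_scale:
  assumes "k \<noteq> 0"
  shows "point (k*x) (k*y) (k*z) = point x y z"
proof (cases "x \<noteq> 0 \<or> y \<noteq> 0 \<or> z \<noteq> 0")
  case True
  then have "k*x \<noteq> 0 \<or> k*y \<noteq> 0 \<or> k*z \<noteq> 0" using assms by simp
  with True show ?thesis using assms by (subst point_eq_iff) blast+
next
  case False
  then show ?thesis by simp
qed

subsection \<open>Lines\<close>

definition line :: "real \<Rightarrow> real \<Rightarrow> real \<Rightarrow> epoint set" where
  "line a b c = {point x y z |x y z. (x \<noteq> 0 \<or> y \<noteq> 0 \<or> z \<noteq> 0) \<and> a*x + b*y + c*z = 0}"

lemma point_on_line_iff:
  assumes "x \<noteq> 0 \<or> y \<noteq> 0 \<or> z \<noteq> 0"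
  shows "point x y z \<in> line a b c \<longleftrightarrow> a*x + b*y + c*z = 0"
proof
  assume "point x y z \<in> line a b c"
  then obtain x' y' z' where n: "x' \<noteq> 0 \<or> y' \<noteq> 0 \<or> z' \<noteq> 0" "a*x' + b*y' + c*z' = 0"
    and "point x y z = point x' y' z'"
    unfolding line_def by blast
  then obtain k where "x = k*x'" "y = k*y'" "z = k*z'"
    using point_eq_iff[OF assms n(1)] by blast
  then have "a*x + b*y + c*z = k * (a*x' + b*y' + c*z')" by (simp add: algebra_simps)
  with n(2) show "a*x + b*y + c*z = 0" by simp
next
  assume "a*x + b*y + c*z = 0"
  with assms show "point x y z \<in> line a b c" unfolding line_def by blast
qed

lemma line_scale: "k \<noteq> 0 \<Longrightarrow> line (k*a) (k*b) (k*c) = line a b c"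
proof -
  assume "k \<noteq> 0"
  have "k*a*x + k*b*y + k*c*z = k * (a*x + b*y + c*z)" for x y z
    by (simp add: algebra_simps)
  with \<open>k \<noteq> 0\<close> show ?thesis unfolding line_def by simp
qed

text \<open>The coordinates of the cross product are written out, so that concrete joins and meets can be
  evaluated by the simplifier.\<close>

lemma ln_through_points:
  assumes n: "a2*b3 - a3*b2 \<noteq> 0 \<or> a3*b1 - a1*b3 \<noteq> 0 \<or> a1*b2 - a2*b1 \<noteq> 0"
  shows "ln_through (point a1 a2 a3) (point b1 b2 b3)
       = line (a2*b3 - a3*b2) (a3*b1 - a1*b3) (a1*b2 - a2*b1)"
proof (rule set_eqI)
  fix X
  obtain x y z where x: "x \<noteq> 0 \<or> y \<noteq> 0 \<or> z \<noteq> 0" and X: "X = point x y z"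
    by (rule point_exhaust)
  have "a1 \<noteq> 0 \<or> a2 \<noteq> 0 \<or> a3 \<noteq> 0" "b1 \<noteq> 0 \<or> b2 \<noteq> 0 \<or> b3 \<noteq> 0" using n by auto
  then have "X \<in> ln_through (point a1 a2 a3) (point b1 b2 b3)
      \<longleftrightarrow> (\<exists>s t. x = s*a1 + t*b1 \<and> y = s*a2 + t*b2 \<and> z = s*a3 + t*b3)"
    unfolding X point_hvec using x
    by (subst hpoint_on_line_iff) (simp_all add: hvec_eq_0_iff hvec_lincomb hvec_eq_iff)
  also have "\<dots> \<longleftrightarrow> (a2*b3 - a3*b2)*x + (a3*b1 - a1*b3)*y + (a1*b2 - a2*b1)*z = 0"
  proof
    assume "(a2*b3 - a3*b2)*x + (a3*b1 - a1*b3)*y + (a1*b2 - a2*b1)*z = 0"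
    from in_plane_spanned[OF n this]
    show "\<exists>s t. x = s*a1 + t*b1 \<and> y = s*a2 + t*b2 \<and> z = s*a3 + t*b3" by blast
  qed (auto simp: algebra_simps)
  finally show "X \<in> ln_through (point a1 a2 a3) (point b1 b2 b3)
      \<longleftrightarrow> X \<in> line (a2*b3 - a3*b2) (a3*b1 - a1*b3) (a1*b2 - a2*b1)"
    using x by (simp add: X point_on_line_iff)
qed

lemma meet_lines:
  assumes n: "a2*b3 - a3*b2 \<noteq> 0 \<or> a3*b1 - a1*b3 \<noteq> 0 \<or> a1*b2 - a2*b1 \<noteq> 0"
  shows "meet (line a1 a2 a3) (line b1 b2 b3)
       = point (a2*b3 - a3*b2) (a3*b1 - a1*b3) (a1*b2 - a2*b1)"
  unfolding meet_def
proof (rule the_equality)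
  show "point (a2*b3 - a3*b2) (a3*b1 - a1*b3) (a1*b2 - a2*b1) \<in> line a1 a2 a3 \<and>
        point (a2*b3 - a3*b2) (a3*b1 - a1*b3) (a1*b2 - a2*b1) \<in> line b1 b2 b3"
    using n by (simp add: point_on_line_iff algebra_simps)
next
  fix X assume XX: "X \<in> line a1 a2 a3 \<and> X \<in> line b1 b2 b3"
  obtain x y z where x: "x \<noteq> 0 \<or> y \<noteq> 0 \<or> z \<noteq> 0" and X: "X = point x y z"
    by (rule point_exhaust)
  have "a1*x + a2*y + a3*z = 0" "b1*x + b2*y + b3*z = 0"
    using XX x by (simp_all add: X point_on_line_iff)
  from orthogonal_both[OF n this] obtain k
    where k: "x = k*(a2*b3 - a3*b2)" "y = k*(a3*b1 - a1*b3)" "z = k*(a1*b2 - a2*b1)" by blast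
  with x have "k \<noteq> 0" by auto
  then show "X = point (a2*b3 - a3*b2) (a3*b1 - a1*b3) (a1*b2 - a2*b1)"
    unfolding X k by (rule point_scale)
qed

lemma linf_line: "linf = line 1 1 1"
proof (rule set_eqI)
  fix X
  obtain x y z where x: "x \<noteq> 0 \<or> y \<noteq> 0 \<or> z \<noteq> 0" and X: "X = point x y z"
    by (rule point_exhaust)
  have "subspace (UNIV \<times> {0} :: ((real^2) \<times> real) set)"
    by (auto simp: subspace_def zero_prod_def)
  then have "X \<in> linf \<longleftrightarrow> hvec x y z \<in> UNIV \<times> {0}"
    unfolding X linf_def mem_Collect_eq point_hvec using x
    by (subst hpoint_subset_iff) (simp_all add: hvec_eq_0_iff)
  also have "\<dots> \<longleftrightarrow> X \<in> line 1 1 1"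
    using x by (simp add: X hvec_def point_on_line_iff)
  finally show "X \<in> linf \<longleftrightarrow> X \<in> line 1 1 1" .
qed

lemma meet_linf:
  assumes "\<not> (a = b \<and> b = c)"
  shows "meet (line a b c) linf = point (b - c) (c - a) (a - b)"
  using meet_lines[of b 1 c 1 1 a] assms by (auto simp: linf_line)

subsection \<open>Affine maps\<close>

text \<open>An affine map of the plane is determined by the images of the vertices, and its extension acts
  on homogeneous coordinates by the same combination of these images; the point of the proof is that
  this also holds at infinity, where the images of differences have to be taken.\<close>

lemma ext_affine_point:
  assumes f: "\<And>x y z. x + y + z = 1 \<Longrightarrow>
      f (x *\<^sub>R A + y *\<^sub>R B + z *\<^sub>R C) = x *\<^sub>R A' + y *\<^sub>R B' + z *\<^sub>R C'"
    and n: "x \<noteq> 0 \<or> y \<noteq> 0 \<or> z \<noteq> 0"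
  shows "ext_affine f (point x y z) = hpoint (x *\<^sub>R A' + y *\<^sub>R B' + z *\<^sub>R C', x + y + z)"
proof -
  let ?L = "\<lambda>(v, w). ((f v - f 0) + w *\<^sub>R f 0, w)"
  let ?u = "\<lambda>x y z. (x *\<^sub>R A' + y *\<^sub>R B' + z *\<^sub>R C', x + y + z)"
  obtain a b c where abc: "a + b + c = 1" "0 = a *\<^sub>R A + b *\<^sub>R B + c *\<^sub>R C"
    by (rule plane_exhaust)
  have f0: "f 0 = a *\<^sub>R A' + b *\<^sub>R B' + c *\<^sub>R C'"
    using f[OF abc(1)] abc(2) by simp
  \<comment> \<open>The origin has normalized coordinates \<open>(a, b, c)\<close>; adding \<open>1 - (x + y + z)\<close> times these
    normalizes \<open>(x, y, z)\<close> without changing the vector that it represents.\<close>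
  have L: "?L (hvec x y z) = ?u x y z" for x y z
  proof -
    define k where "k = 1 - (x + y + z)"
    have "(x + k*a) + (y + k*b) + (z + k*c) = (x + y + z) + k * (a + b + c)"
      by (simp add: algebra_simps)
    then have s: "(x + k*a) + (y + k*b) + (z + k*c) = 1"
      by (simp add: abc(1) k_def)
    have "x *\<^sub>R A + y *\<^sub>R B + z *\<^sub>R C
        = (x *\<^sub>R A + y *\<^sub>R B + z *\<^sub>R C) + k *\<^sub>R (a *\<^sub>R A + b *\<^sub>R B + c *\<^sub>R C)"
      by (simp add: abc(2)[symmetric])
    also have "\<dots> = (x + k*a) *\<^sub>R A + (y + k*b) *\<^sub>R B + (z + k*c) *\<^sub>R C"
      by (simp add: algebra_simps)
    finally have "f (x *\<^sub>R A + y *\<^sub>R B + z *\<^sub>R C)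
        = (x + k*a) *\<^sub>R A' + (y + k*b) *\<^sub>R B' + (z + k*c) *\<^sub>R C'"
      using f[OF s] by simp
    also have "\<dots> = (x *\<^sub>R A' + y *\<^sub>R B' + z *\<^sub>R C') + k *\<^sub>R f 0"
      by (simp add: f0 algebra_simps)
    finally have "f (x *\<^sub>R A + y *\<^sub>R B + z *\<^sub>R C) - f 0 + (x + y + z) *\<^sub>R f 0
        = x *\<^sub>R A' + y *\<^sub>R B' + z *\<^sub>R C'"
      by (simp add: k_def algebra_simps)
    then show ?thesis by (simp add: hvec_def)
  qed
  have "subspace_of (point x y z) = range (\<lambda>k. hvec (k*x) (k*y) (k*z))"
    using n by (simp add: point_hvec subspace_of_hpoint hvec_eq_0_iff span_singleton hvec_scale)
  then have "?L ` subspace_of (point x y z) = range (\<lambda>k. ?L (hvec (k*x) (k*y) (k*z)))"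
    by (simp only: image_image)
  also have "\<dots> = range (\<lambda>k. k *\<^sub>R ?u x y z)"
    unfolding L by (simp add: algebra_simps)
  also have "\<dots> = span {?u x y z}"
    by (simp only: span_singleton)
  finally show ?thesis
    unfolding ext_affine_def hpoint_def by simp
qed

lemma complement_point:
  assumes "x \<noteq> 0 \<or> y \<noteq> 0 \<or> z \<noteq> 0"
  shows "complement A B C (point x y z) = point (y + z) (z + x) (x + y)"
proof -
  have "complement_map A B C (x *\<^sub>R A + y *\<^sub>R B + z *\<^sub>R C)
      = x *\<^sub>R ((1/2) *\<^sub>R (B + C)) + y *\<^sub>R ((1/2) *\<^sub>R (C + A)) + z *\<^sub>R ((1/2) *\<^sub>R (A + B))"
    if s: "x + y + z = 1" for x y z
  proof -
    have x: "x = 1 - y - z" using s by simp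
    show ?thesis
      unfolding complement_map_def centroid_def x by (simp add: vec_eq_iff field_simps)
  qed
  from ext_affine_point[OF this assms]
  have "complement A B C (point x y z) = hpoint
      (x *\<^sub>R ((1/2) *\<^sub>R (B + C)) + y *\<^sub>R ((1/2) *\<^sub>R (C + A)) + z *\<^sub>R ((1/2) *\<^sub>R (A + B)), x + y + z)"
    unfolding complement_def .
  also have "\<dots> = point ((1/2)*(y + z)) ((1/2)*(z + x)) ((1/2)*(x + y))"
    unfolding bary_def by (rule arg_cong[of _ _ hpoint]) (simp add: vec_eq_iff field_simps)
  also have "\<dots> = point (y + z) (z + x) (x + y)"
    by (rule point_scale) simp
  finally show ?thesis .
qed

lemma isotomic_point:
  assumes "x \<noteq> 0" "y \<noteq> 0" "z \<noteq> 0"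
  shows "isotomic A B C (point x y z) = point (1/x) (1/y) (1/z)"
  unfolding isotomic_def
proof (rule the_equality)
  fix Y
  assume "\<exists>x' y' z'. x' \<noteq> 0 \<and> y' \<noteq> 0 \<and> z' \<noteq> 0 \<and> point x y z = point x' y' z' \<and>
      Y = point (1/x') (1/y') (1/z')"
  then obtain x' y' z' where x': "x' \<noteq> 0" "y' \<noteq> 0" "z' \<noteq> 0" "point x y z = point x' y' z'"
    and Y: "Y = point (1/x') (1/y') (1/z')" by blast
  then obtain k where "k \<noteq> 0" and k: "x = k*x'" "y = k*y'" "z = k*z'"
    using assms by (auto simp: point_eq_iff)
  then have "point (1/x') (1/y') (1/z') = point (k*(1/x)) (k*(1/y)) (k*(1/z))" by simp
  also have "\<dots> = point (1/x) (1/y) (1/z)" using \<open>k \<noteq> 0\<close> by (rule point_scale)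
  finally show "Y = point (1/x) (1/y) (1/z)" by (simp only: Y)
qed (use assms in blast)

lemma bary_square_point:
  assumes n: "x \<noteq> 0 \<or> y \<noteq> 0 \<or> z \<noteq> 0"
  shows "bary_square A B C (point x y z) = point (x^2) (y^2) (z^2)"
  unfolding bary_square_def
proof (rule the_equality)
  fix Y
  assume "\<exists>x' y' z'. (x', y', z') \<noteq> (0, 0, 0) \<and> point x y z = point x' y' z' \<and>
      Y = point (x'^2) (y'^2) (z'^2)"
  then obtain x' y' z' where x': "(x', y', z') \<noteq> (0, 0, 0)" "point x y z = point x' y' z'"
    and Y: "Y = point (x'^2) (y'^2) (z'^2)" by blast
  then have "x' \<noteq> 0 \<or> y' \<noteq> 0 \<or> z' \<noteq> 0" by auto
  with n x'(2) obtain k where "k \<noteq> 0" and k: "x = k*x'" "y = k*y'" "z = k*z'"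
    by (auto simp: point_eq_iff)
  have "point (x^2) (y^2) (z^2) = point (k^2 * x'^2) (k^2 * y'^2) (k^2 * z'^2)"
    by (simp add: k power_mult_distrib)
  also have "\<dots> = Y" unfolding Y using \<open>k \<noteq> 0\<close> by (intro point_scale) simp
  finally show "Y = point (x^2) (y^2) (z^2)" by simp
qed (use n in auto)

text \<open>The reflection moves \<open>X\<close> along the direction \<open>d\<close>, by twice what it takes to make the linear
  form of the mirror vanish.  Since \<open>d\<close> has coordinate sum \<open>0\<close>, the coordinates stay normalized.\<close>

lemma aff_reflection_eq:
  assumes m: "meet m linf = point d1 d2 d3" and d: "d1 + d2 + d3 = 0"
    and transversal: "l1*d1 + l2*d2 + l3*d3 \<noteq> 0" and X: "x + y + z = 1"
  defines "t \<equiv> - 2 * (l1*x + l2*y + l3*z) / (l1*d1 + l2*d2 + l3*d3)"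
  shows "aff_reflection (line l1 l2 l3) m (x *\<^sub>R A + y *\<^sub>R B + z *\<^sub>R C)
       = (x + t*d1) *\<^sub>R A + (y + t*d2) *\<^sub>R B + (z + t*d3) *\<^sub>R C"
proof -
  let ?X = "x *\<^sub>R A + y *\<^sub>R B + z *\<^sub>R C"
  have dn: "d1 \<noteq> 0 \<or> d2 \<noteq> 0 \<or> d3 \<noteq> 0" using transversal by auto
  have xn: "x \<noteq> 0 \<or> y \<noteq> 0 \<or> z \<noteq> 0" using X by auto
  have par: "pt (y1 *\<^sub>R A + y2 *\<^sub>R B + y3 *\<^sub>R C) \<in> par_through (pt ?X) m
      \<longleftrightarrow> (\<exists>s. y1 = x + s*d1 \<and> y2 = y + s*d2 \<and> y3 = z + s*d3)"
    if Y: "y1 + y2 + y3 = 1" for y1 y2 y3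
  proof -
    have yn: "y1 \<noteq> 0 \<or> y2 \<noteq> 0 \<or> y3 \<noteq> 0" using Y by auto
    have "pt (y1 *\<^sub>R A + y2 *\<^sub>R B + y3 *\<^sub>R C) \<in> par_through (pt ?X) m
      \<longleftrightarrow> (\<exists>r s. y1 = r*x + s*d1 \<and> y2 = r*y + s*d2 \<and> y3 = r*z + s*d3)"
      unfolding par_through_def m pt_point[OF Y] pt_point[OF X] point_hvec using yn dn xn
      by (subst hpoint_on_line_iff) (simp_all add: hvec_eq_0_iff hvec_lincomb hvec_eq_iff)
    also have "\<dots> \<longleftrightarrow> (\<exists>s. y1 = x + s*d1 \<and> y2 = y + s*d2 \<and> y3 = z + s*d3)"
    proof
      assume "\<exists>r s. y1 = r*x + s*d1 \<and> y2 = r*y + s*d2 \<and> y3 = r*z + s*d3"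
      then obtain r s where rs: "y1 = r*x + s*d1" "y2 = r*y + s*d2" "y3 = r*z + s*d3" by blast
      then have "y1 + y2 + y3 = r * (x + y + z) + s * (d1 + d2 + d3)" by (simp add: algebra_simps)
      with X Y d have "r = 1" by simp
      with rs show "\<exists>s. y1 = x + s*d1 \<and> y2 = y + s*d2 \<and> y3 = z + s*d3" by auto
    next
      assume "\<exists>s. y1 = x + s*d1 \<and> y2 = y + s*d2 \<and> y3 = z + s*d3"
      then show "\<exists>r s. y1 = r*x + s*d1 \<and> y2 = r*y + s*d2 \<and> y3 = r*z + s*d3"
        by (metis mult_1)
    qed
    finally show ?thesis .
  qed
  have mid: "pt (midpoint ?X ((x + s*d1) *\<^sub>R A + (y + s*d2) *\<^sub>R B + (z + s*d3) *\<^sub>R C)) \<in> line l1 l2 l3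
      \<longleftrightarrow> s = t" for s
  proof -
    have "midpoint ?X ((x + s*d1) *\<^sub>R A + (y + s*d2) *\<^sub>R B + (z + s*d3) *\<^sub>R C)
        = (x + s/2*d1) *\<^sub>R A + (y + s/2*d2) *\<^sub>R B + (z + s/2*d3) *\<^sub>R C"
      by (simp add: midpoint_def vec_eq_iff field_simps)
    moreover have sum: "(x + s/2*d1) + (y + s/2*d2) + (z + s/2*d3) = 1"
    proof -
      have "(x + s/2*d1) + (y + s/2*d2) + (z + s/2*d3) = (x + y + z) + s/2*(d1 + d2 + d3)"
        by (simp add: algebra_simps)
      then show ?thesis using X d by simp
    qed
    moreover have "x + s/2*d1 \<noteq> 0 \<or> y + s/2*d2 \<noteq> 0 \<or> z + s/2*d3 \<noteq> 0"
      using sum by linarith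
    ultimately have "pt (midpoint ?X ((x + s*d1) *\<^sub>R A + (y + s*d2) *\<^sub>R B + (z + s*d3) *\<^sub>R C))
        \<in> line l1 l2 l3
        \<longleftrightarrow> l1*(x + s/2*d1) + l2*(y + s/2*d2) + l3*(z + s/2*d3) = 0"
      by (simp only: pt_point point_on_line_iff)
    also have "\<dots> \<longleftrightarrow> s * (l1*d1 + l2*d2 + l3*d3) = - 2 * (l1*x + l2*y + l3*z)"
      by (auto simp: field_simps)
    also have "\<dots> \<longleftrightarrow> s = t"
      unfolding t_def using transversal by (simp add: eq_divide_eq)
    finally show ?thesis .
  qed
  have sumt: "(x + s*d1) + (y + s*d2) + (z + s*d3) = 1" for s
  proof -
    have "(x + s*d1) + (y + s*d2) + (z + s*d3) = (x + y + z) + s*(d1 + d2 + d3)"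
      by (simp add: algebra_simps)
    then show ?thesis using X d by simp
  qed
  show ?thesis
    unfolding aff_reflection_def
  proof (rule the_equality)
    show "pt ((x + t*d1) *\<^sub>R A + (y + t*d2) *\<^sub>R B + (z + t*d3) *\<^sub>R C) \<in> par_through (pt ?X) m \<and>
        pt (midpoint ?X ((x + t*d1) *\<^sub>R A + (y + t*d2) *\<^sub>R B + (z + t*d3) *\<^sub>R C)) \<in> line l1 l2 l3"
      using mid[of t] par[OF sumt] by blast
  next
    fix Y
    assume Y: "pt Y \<in> par_through (pt ?X) m \<and> pt (midpoint ?X Y) \<in> line l1 l2 l3"
    obtain y1 y2 y3 where s: "y1 + y2 + y3 = 1" and Yeq: "Y = y1 *\<^sub>R A + y2 *\<^sub>R B + y3 *\<^sub>R C"
      by (rule plane_exhaust)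
    from Y[unfolded Yeq] par[OF s] obtain r
      where r: "y1 = x + r*d1" "y2 = y + r*d2" "y3 = z + r*d3" by blast
    with Y Yeq have "r = t" by (simp add: mid[of r, symmetric])
    with r Yeq show "Y = (x + t*d1) *\<^sub>R A + (y + t*d2) *\<^sub>R B + (z + t*d3) *\<^sub>R C" by simp
  qed
qed

text \<open>The shift in direction \<open>d\<close> is linear in \<open>(x, y, z)\<close>, so the formula for normalized coordinates is
  that of an affine map and passes to arbitrary homogeneous coordinates.\<close>

lemma ext_aff_reflection_point:
  assumes m: "meet m linf = point d1 d2 d3" and d: "d1 + d2 + d3 = 0"
    and transversal: "l1*d1 + l2*d2 + l3*d3 \<noteq> 0" and X: "x \<noteq> 0 \<or> y \<noteq> 0 \<or> z \<noteq> 0"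
  defines "t \<equiv> - 2 * (l1*x + l2*y + l3*z) / (l1*d1 + l2*d2 + l3*d3)"
  shows "ext_affine (aff_reflection (line l1 l2 l3) m) (point x y z)
       = point (x + t*d1) (y + t*d2) (z + t*d3)"
proof -
  define D where "D = d1 *\<^sub>R A + d2 *\<^sub>R B + d3 *\<^sub>R C"
  define n where "n = - 2 / (l1*d1 + l2*d2 + l3*d3)"
  have t: "t = n * (l1*x + l2*y + l3*z)" by (simp only: t_def n_def times_divide_eq_left)
  have "aff_reflection (line l1 l2 l3) m (x *\<^sub>R A + y *\<^sub>R B + z *\<^sub>R C)
      = x *\<^sub>R (A + (n*l1) *\<^sub>R D) + y *\<^sub>R (B + (n*l2) *\<^sub>R D) + z *\<^sub>R (C + (n*l3) *\<^sub>R D)"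
    if "x + y + z = 1" for x y z
  proof -
    have "- 2 * (l1*x + l2*y + l3*z) / (l1*d1 + l2*d2 + l3*d3) = n * (l1*x + l2*y + l3*z)"
      by (simp only: n_def times_divide_eq_left)
    then show ?thesis
      unfolding aff_reflection_eq[OF m d transversal that] by (simp add: D_def algebra_simps)
  qed
  from ext_affine_point[OF this X]
  have "ext_affine (aff_reflection (line l1 l2 l3) m) (point x y z) = hpoint
     (x *\<^sub>R (A + (n*l1) *\<^sub>R D) + y *\<^sub>R (B + (n*l2) *\<^sub>R D) + z *\<^sub>R (C + (n*l3) *\<^sub>R D), x + y + z)" .
  also have "\<dots> = point (x + t*d1) (y + t*d2) (z + t*d3)"
  proof -
    have "(x + t*d1) + (y + t*d2) + (z + t*d3) = x + y + z + t * (d1 + d2 + d3)"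
      by (simp add: algebra_simps)
    then have "(x + t*d1) + (y + t*d2) + (z + t*d3) = x + y + z" by (simp add: d)
    then show ?thesis
      unfolding bary_def by (simp only:) (simp add: t D_def algebra_simps)
  qed
  finally show ?thesis .
qed


text \<open>Three lines through the vertices whose equations are in the form of Ceva's theorem.  Both triples of
  lines below have this form: those of the orthocenter with \<open>(e, f, g) = (\<sigma> - p\<^sup>2, \<sigma> - q\<^sup>2, \<sigma> - r\<^sup>2)\<close>, and
  those defining the generalized isogonal image of the centroid with \<open>e = f = g = 1\<close>.  One of \<open>e, f, g\<close>
  may vanish; the common point is then a vertex, which is what identifies the excluded positions of
  the orthocenter.\<close>

lemma THE_concurrent_cevians:
  assumes "a \<noteq> 0" "b \<noteq> 0" "c \<noteq> 0"
    and e: "e \<noteq> 0 \<and> f \<noteq> 0 \<or> f \<noteq> 0 \<and> g \<noteq> 0 \<or> g \<noteq> 0 \<and> e \<noteq> 0"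
  shows "(THE X. X \<in> line 0 (- (c*f)) (b*g) \<and> X \<in> line (c*e) 0 (- (a*g)) \<and>
                 X \<in> line (- (b*e)) (a*f) 0)
       = point (a*(f*g)) (b*(g*e)) (c*(e*f))"
proof (rule the_equality)
  have n: "a*(f*g) \<noteq> 0 \<or> b*(g*e) \<noteq> 0 \<or> c*(e*f) \<noteq> 0"
    using assms by auto
  show "point (a*(f*g)) (b*(g*e)) (c*(e*f)) \<in> line 0 (- (c*f)) (b*g) \<and>
      point (a*(f*g)) (b*(g*e)) (c*(e*f)) \<in> line (c*e) 0 (- (a*g)) \<and>
      point (a*(f*g)) (b*(g*e)) (c*(e*f)) \<in> line (- (b*e)) (a*f) 0"
    unfolding point_on_line_iff[OF n] by simp
  fix X
  assume XX: "X \<in> line 0 (- (c*f)) (b*g) \<and> X \<in> line (c*e) 0 (- (a*g)) \<and>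
      X \<in> line (- (b*e)) (a*f) 0"
  obtain x y z where x: "x \<noteq> 0 \<or> y \<noteq> 0 \<or> z \<noteq> 0" and X: "X = point x y z"
    by (rule point_exhaust)
  have eqs: "c*f*y = b*g*z" "c*e*x = a*g*z" "b*e*x = a*f*y"
    using XX x by (simp_all add: X point_on_line_iff)
  obtain k where k: "x = k*(a*(f*g))" "y = k*(b*(g*e))" "z = k*(c*(e*f))"
  proof (rule cross_eq_0[OF n, of z y x])
    show "b*(g*e)*z = c*(e*f)*y" using eqs(1) by algebra
    show "c*(e*f)*x = a*(f*g)*z" using eqs(2) by algebra
    show "a*(f*g)*y = b*(g*e)*x" using eqs(3) by algebra
  qed (rule that)
  with x have "k \<noteq> 0" by auto
  then show "X = point (a*(f*g)) (b*(g*e)) (c*(e*f))"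
    unfolding X k by (rule point_scale)
qed

lemma sides_lines: "sides A B C = line 1 0 0 \<union> line 0 1 0 \<union> line 0 0 1"
  by (simp add: sides_def pt_vertices ln_through_points)

lemma anticomplementary_sides_lines:
  "anticomplementary_sides A B C = line 0 1 1 \<union> line 1 0 1 \<union> line 1 1 0"
proof -
  have inv: "inv (complement_map A B C) X = A + B + C - 2 *\<^sub>R X" for X
  proof (rule inv_f_eq)
    show "inj (complement_map A B C)"
      by (rule injI) (simp add: complement_map_def)
    show "complement_map A B C (A + B + C - 2 *\<^sub>R X) = X"
      by (simp add: complement_map_def centroid_def vec_eq_iff field_simps)
  qed
  have "A + B + C - 2 *\<^sub>R A = (-1) *\<^sub>R A + 1 *\<^sub>R B + 1 *\<^sub>R C"
    "A + B + C - 2 *\<^sub>R B = 1 *\<^sub>R A + (-1) *\<^sub>R B + 1 *\<^sub>R C"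
    "A + B + C - 2 *\<^sub>R C = 1 *\<^sub>R A + 1 *\<^sub>R B + (-1) *\<^sub>R C"
    by (simp_all add: vec_eq_iff)
  then have pts: "pt (A + B + C - 2 *\<^sub>R A) = point (-1) 1 1"
    "pt (A + B + C - 2 *\<^sub>R B) = point 1 (-1) 1"
    "pt (A + B + C - 2 *\<^sub>R C) = point 1 1 (-1)"
    by (simp_all only: pt_point)
  show ?thesis
    unfolding anticomplementary_sides_def Let_def sides_def inv pts
    using line_scale[of 2 0 1 1] line_scale[of 2 1 0 1] line_scale[of 2 1 1 0]
    by (simp add: ln_through_points)
qed

end

section \<open>The points and maps belonging to P\<close>

lemma same_square:
  assumes "x \<noteq> 0" "y \<noteq> 0" "z \<noteq> 0" "x + y \<noteq> (0::real)"
    and "x*y + y*z + z*x = x^2" "x*y + y*z + z*x = y^2"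
  shows False
proof -
  have "(x - y) * (x + y) = 0" using assms(5,6) by (simp add: power2_eq_square algebra_simps)
  with assms(4) have "x = y" by simp
  with assms(5) have "x * z = 0" by (simp add: power2_eq_square)
  with assms show False by simp
qed

locale triangle_point = triangle +
  fixes p q r :: real
  assumes off_sides: "p \<noteq> 0" "q \<noteq> 0" "r \<noteq> 0"
    and off_anticomplementary_sides: "q + r \<noteq> 0" "r + p \<noteq> 0" "p + q \<noteq> 0"
begin

abbreviation P :: epoint where "P \<equiv> point p q r"

text \<open>\<open>(u : v : w)\<close> is \<open>Q\<close>.  Its coordinate sum is \<open>2 \<sigma>\<close>, so \<open>Q\<close> is at infinity iff \<open>\<sigma> = 0\<close>.\<close>

definition u where "u = p * (q + r)"
definition v where "v = q * (r + p)"
definition w where "w = r * (p + q)"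
definition \<sigma> where "\<sigma> = p*q + q*r + r*p"

lemmas uvw_defs = u_def v_def w_def

lemma uvw_nonzero: "u \<noteq> 0" "v \<noteq> 0" "w \<noteq> 0"
  using off_sides off_anticomplementary_sides by (simp_all add: uvw_defs)

lemma Q_eq: "Q_pt A B C P = point u v w"
proof -
  have "Q_pt A B C P = point (1/q + 1/r) (1/r + 1/p) (1/p + 1/q)"
    unfolding Q_pt_def using off_sides by (simp add: isotomic_point complement_point)
  also have "\<dots> = point (p*q*r*(1/q + 1/r)) (p*q*r*(1/r + 1/p)) (p*q*r*(1/p + 1/q))"
    using off_sides by (intro point_scale[symmetric]) simp
  finally have Q: "Q_pt A B C P
      = point (p*q*r*(1/q + 1/r)) (p*q*r*(1/r + 1/p)) (p*q*r*(1/p + 1/q))" .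
  have "p*q*r*(1/q + 1/r) = u" "p*q*r*(1/r + 1/p) = v" "p*q*r*(1/p + 1/q) = w"
    using off_sides by (simp_all add: uvw_defs field_simps)
  then show ?thesis by (simp only: Q)
qed

lemma DEF_eq:
  "D_pt A B C P = point 0 q r" "E_pt A B C P = point p 0 r" "F_pt A B C P = point p q 0"
  unfolding D_pt_def E_pt_def F_pt_def pt_vertices using off_sides
  by (simp_all add: ln_through_points meet_lines)

lemma AQ_BQ_CQ:
  "ln_through (pt A) (point u v w) = line 0 (- w) v"
  "ln_through (pt B) (point u v w) = line w 0 (- u)"
  "ln_through (pt C) (point u v w) = line (- v) u 0"
  unfolding pt_vertices using uvw_nonzero by (simp_all add: ln_through_points)

text \<open>The sides of the cevian triangle have the points at infinity that make the reflections compatible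
  with \<open>Q\<close>: up to sign, two coordinates of each direction are the coordinates of \<open>Q\<close> itself.\<close>

lemma directions_DEF:
  "meet (ln_through (point p 0 r) (point p q 0)) linf = point (p*(r - q)) v (- w)"
  "meet (ln_through (point 0 q r) (point p q 0)) linf = point u (q*(r - p)) (- w)"
  "meet (ln_through (point 0 q r) (point p 0 r)) linf = point u (- v) (r*(q - p))"
proof -
  have n: "r*p + r*q \<noteq> 0" "q*r + q*p \<noteq> 0"
    using off_sides off_anticomplementary_sides by (simp_all flip: distrib_left add: add.commute)
  show "meet (ln_through (point p 0 r) (point p q 0)) linf = point (p*(r - q)) v (- w)"
  proof -
    have "ln_through (point p 0 r) (point p q 0) = line (- (r*q)) (r*p) (p*q)"
      using off_sides by (simp add: ln_through_points)
    moreover have "\<not> (- (r*q) = r*p \<and> r*p = p*q)" using n by auto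
    moreover have "r*p - p*q = p*(r - q)" "p*q - - (r*q) = v" "- (r*q) - r*p = - w"
      by (simp_all add: uvw_defs algebra_simps)
    ultimately show ?thesis by (simp only: meet_linf not_False_eq_True)
  qed
  show "meet (ln_through (point 0 q r) (point p q 0)) linf = point u (q*(r - p)) (- w)"
  proof -
    have "ln_through (point 0 q r) (point p q 0) = line (- (r*q)) (r*p) (- (q*p))"
      using off_sides by (simp add: ln_through_points)
    moreover have "\<not> (- (r*q) = r*p \<and> r*p = - (q*p))" using n by auto
    moreover have "r*p - - (q*p) = u" "- (q*p) - - (r*q) = q*(r - p)" "- (r*q) - r*p = - w"
      by (simp_all add: uvw_defs algebra_simps)
    ultimately show ?thesis by (simp only: meet_linf not_False_eq_True)
  qed
  show "meet (ln_through (point 0 q r) (point p 0 r)) linf = point u (- v) (r*(q - p))"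
  proof -
    have "ln_through (point 0 q r) (point p 0 r) = line (q*r) (r*p) (- (q*p))"
      using off_sides by (simp add: ln_through_points)
    moreover have "\<not> (q*r = r*p \<and> r*p = - (q*p))" using n(2) by (metis eq_neg_iff_add_eq_0)
    moreover have "r*p - - (q*p) = u" "- (q*p) - q*r = - v" "q*r - r*p = r*(q - p)"
      by (simp_all add: uvw_defs algebra_simps)
    ultimately show ?thesis by (simp only: meet_linf not_False_eq_True)
  qed
qed

subsection \<open>The image of the centroid\<close>

text \<open>The reflection about \<open>AQ\<close> exchanges \<open>y/v\<close> and \<open>z/w\<close>.  For \<open>y = z\<close> this gives \<open>y : z = v\<^sup>2 : w\<^sup>2\<close>,
  and only this ratio matters for the line through \<open>A\<close>.\<close>

lemma line_A_reflected_centroid: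
  "ln_through (pt A) (ext_affine (aff_reflection (ln_through (pt A) (point u v w))
     (ln_through (point p 0 r) (point p q 0))) (pt (centroid A B C))) = line 0 (- (w^2)) (v^2)"
proof -
  \<comment> \<open>The linear form of the mirror, evaluated at the direction of the reflection.\<close>
  have tr: "0*(p*(r - q)) + - w * v + v * (- w) \<noteq> 0" using uvw_nonzero by simp
  have sum0: "p*(r - q) + v + - w = 0" by (simp add: uvw_defs algebra_simps)
  define t where "t = - 2 * (0 * (1/3) + (- w) * (1/3) + v * (1/3)) / (0 * (p*(r - q)) + (- w) * v + v * (- w))"
  have "1/3 + t * v = v/(3*w)" "1/3 + t * (- w) = w/(3 * v)"
    unfolding t_def using uvw_nonzero by (simp_all add: field_simps)
  moreover have "ext_affine (aff_reflection (ln_through (pt A) (point u v w))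
     (ln_through (point p 0 r) (point p q 0))) (pt (centroid A B C))
     = point (1/3 + t * (p*(r - q))) (1/3 + t * v) (1/3 + t * (- w))"
    unfolding AQ_BQ_CQ pt_centroid t_def
    by (rule ext_aff_reflection_point[OF directions_DEF(1) sum0 tr]) simp
  moreover have "line 0 (- (w/(3 * v))) (v/(3*w)) = line 0 (- (w^2)) (v^2)"
    using line_scale[of "1/(3 * v * w)" 0 "- (w^2)" "v^2"] uvw_nonzero
    by (simp add: power2_eq_square)
  ultimately show ?thesis
    using uvw_nonzero by (simp add: pt_vertices ln_through_points)
qed

lemma line_B_reflected_centroid:
  "ln_through (pt B) (ext_affine (aff_reflection (ln_through (pt B) (point u v w))
     (ln_through (point 0 q r) (point p q 0))) (pt (centroid A B C))) = line (w^2) 0 (- (u^2))"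
proof -
  have tr: "w*u + 0*(q*(r - p)) + - u*(- w) \<noteq> 0" using uvw_nonzero by simp
  have sum0: "u + q*(r - p) + - w = 0" by (simp add: uvw_defs algebra_simps)
  define t where "t = - 2 * (w * (1/3) + 0 * (1/3) + (- u) * (1/3)) / (w * u + 0 * (q*(r - p)) + (- u) * (- w))"
  have "1/3 + t * u = u/(3*w)" "1/3 + t * (- w) = w/(3*u)"
    unfolding t_def using uvw_nonzero by (simp_all add: field_simps)
  moreover have "ext_affine (aff_reflection (ln_through (pt B) (point u v w))
     (ln_through (point 0 q r) (point p q 0))) (pt (centroid A B C))
     = point (1/3 + t * u) (1/3 + t * (q*(r - p))) (1/3 + t * (- w))"
    unfolding AQ_BQ_CQ pt_centroid t_def
    by (rule ext_aff_reflection_point[OF directions_DEF(2) sum0 tr]) simp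
  moreover have "line (w/(3*u)) 0 (- (u/(3*w))) = line (w^2) 0 (- (u^2))"
    using line_scale[of "1/(3*u*w)" "w^2" 0 "- (u^2)"] uvw_nonzero
    by (simp add: power2_eq_square)
  ultimately show ?thesis
    using uvw_nonzero by (simp add: pt_vertices ln_through_points)
qed

lemma line_C_reflected_centroid:
  "ln_through (pt C) (ext_affine (aff_reflection (ln_through (pt C) (point u v w))
     (ln_through (point 0 q r) (point p 0 r))) (pt (centroid A B C))) = line (- (v^2)) (u^2) 0"
proof -
  have tr: "- v * u + u*(- v) + 0*(r*(q - p)) \<noteq> 0" using uvw_nonzero by simp
  have sum0: "u + - v + r*(q - p) = 0" by (simp add: uvw_defs algebra_simps)
  define t where "t = - 2 * ((- v) * (1/3) + u * (1/3) + 0 * (1/3)) / ((- v) * u + u * (- v) + 0 * (r*(q - p)))"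
  have "1/3 + t * u = u/(3 * v)" "1/3 + t * (- v) = v/(3*u)"
    unfolding t_def using uvw_nonzero by (simp_all add: field_simps)
  moreover have "ext_affine (aff_reflection (ln_through (pt C) (point u v w))
     (ln_through (point 0 q r) (point p 0 r))) (pt (centroid A B C))
     = point (1/3 + t * u) (1/3 + t * (- v)) (1/3 + t * (r*(q - p)))"
    unfolding AQ_BQ_CQ pt_centroid t_def
    by (rule ext_aff_reflection_point[OF directions_DEF(3) sum0 tr]) simp
  moreover have "line (- (v/(3*u))) (u/(3 * v)) 0 = line (- (v^2)) (u^2) 0"
    using line_scale[of "1/(3*u * v)" "- (v^2)" "u^2" 0] uvw_nonzero
    by (simp add: power2_eq_square)
  ultimately show ?thesis
    using uvw_nonzero by (simp add: pt_vertices ln_through_points)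
qed

lemma gen_isogonal_centroid:
  "gen_isogonal A B C P (pt (centroid A B C)) = point (u^2) (v^2) (w^2)"
  unfolding gen_isogonal_def Let_def Q_eq DEF_eq
    line_A_reflected_centroid line_B_reflected_centroid line_C_reflected_centroid
  using THE_concurrent_cevians[of "u^2" "v^2" "w^2" 1 1 1] uvw_nonzero by simp

subsection \<open>The generalized orthocenter\<close>

text \<open>If \<open>\<sigma>\<close> were the square of two of \<open>p, q, r\<close>, these would be equal up to sign, hence equal since their
  sum is nonzero, and then \<open>\<sigma>\<close> would exceed that square by twice the product with the third.  So the three
  parallels that define the orthocenter always have a unique common point.\<close>

lemma at_most_one_square:
  "\<sigma> - p^2 \<noteq> 0 \<and> \<sigma> - q^2 \<noteq> 0 \<or> \<sigma> - q^2 \<noteq> 0 \<and> \<sigma> - r^2 \<noteq> 0 \<or> \<sigma> - r^2 \<noteq> 0 \<and> \<sigma> - p^2 \<noteq> 0"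
proof -
  have "\<not> (\<sigma> = p^2 \<and> \<sigma> = q^2)"
    using same_square[of p q r] off_sides off_anticomplementary_sides by (auto simp: \<sigma>_def)
  moreover have "\<not> (\<sigma> = q^2 \<and> \<sigma> = r^2)"
    using same_square[of q r p] off_sides off_anticomplementary_sides
    by (auto simp: \<sigma>_def algebra_simps)
  moreover have "\<not> (\<sigma> = r^2 \<and> \<sigma> = p^2)"
    using same_square[of r p q] off_sides off_anticomplementary_sides
    by (auto simp: \<sigma>_def algebra_simps)
  ultimately show ?thesis by auto
qed

lemma directions_QD_QE_QF:
  "meet (ln_through (point u v w) (point 0 q r)) linf
     = point (- (u*(q + r))) (q*(\<sigma> - r^2)) (r*(\<sigma> - q^2))"
  "meet (ln_through (point u v w) (point p 0 r)) linf
     = point (p*(\<sigma> - r^2)) (- (v * (r + p))) (r*(\<sigma> - p^2))"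
  "meet (ln_through (point u v w) (point p q 0)) linf
     = point (p*(\<sigma> - q^2)) (q*(\<sigma> - p^2)) (- (w*(p + q)))"
proof -
  have n: "u*q + u*r \<noteq> 0" "v * r + v * p \<noteq> 0" "w*p + w*q \<noteq> 0"
    using uvw_nonzero off_anticomplementary_sides by (simp_all flip: distrib_left)
  show "meet (ln_through (point u v w) (point 0 q r)) linf
     = point (- (u*(q + r))) (q*(\<sigma> - r^2)) (r*(\<sigma> - q^2))"
  proof -
    have "ln_through (point u v w) (point 0 q r) = line (v * r - w*q) (- (u*r)) (u*q)"
      using uvw_nonzero off_sides by (simp add: ln_through_points)
    moreover have "\<not> (v * r - w*q = - (u*r) \<and> - (u*r) = u*q)" using n by auto
    ultimately show ?thesis
      by (simp add: meet_linf) (simp add: uvw_defs \<sigma>_def power2_eq_square algebra_simps)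
  qed
  show "meet (ln_through (point u v w) (point p 0 r)) linf
     = point (p*(\<sigma> - r^2)) (- (v * (r + p))) (r*(\<sigma> - p^2))"
  proof -
    have "ln_through (point u v w) (point p 0 r) = line (v * r) (w*p - u*r) (- (v * p))"
      using uvw_nonzero off_sides by (simp add: ln_through_points)
    moreover have "\<not> (v * r = w*p - u*r \<and> w*p - u*r = - (v * p))" using n by auto
    ultimately show ?thesis
      by (simp add: meet_linf) (simp add: uvw_defs \<sigma>_def power2_eq_square algebra_simps)
  qed
  show "meet (ln_through (point u v w) (point p q 0)) linf
     = point (p*(\<sigma> - q^2)) (q*(\<sigma> - p^2)) (- (w*(p + q)))"
  proof -
    have "ln_through (point u v w) (point p q 0) = line (- (w*q)) (w*p) (u*q - v * p)"
      using uvw_nonzero off_sides by (simp add: ln_through_points)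
    moreover have "\<not> (- (w*q) = w*p \<and> w*p = u*q - v * p)" using n by auto
    ultimately show ?thesis
      by (simp add: meet_linf) (simp add: uvw_defs \<sigma>_def power2_eq_square algebra_simps)
  qed
qed

lemma parallels_QD_QE_QF:
  "par_through (pt A) (ln_through (point u v w) (point 0 q r))
     = line 0 (- (r*(\<sigma> - q^2))) (q*(\<sigma> - r^2))"
  "par_through (pt B) (ln_through (point u v w) (point p 0 r))
     = line (r*(\<sigma> - p^2)) 0 (- (p*(\<sigma> - r^2)))"
  "par_through (pt C) (ln_through (point u v w) (point p q 0))
     = line (- (q*(\<sigma> - p^2))) (p*(\<sigma> - q^2)) 0"
  unfolding par_through_def directions_QD_QE_QF pt_vertices
  using at_most_one_square off_sides
  by (subst ln_through_points; auto)+

text \<open>For \<open>\<sigma> \<noteq> 0\<close> this is the common point of the three parallels.  For \<open>\<sigma> = 0\<close> the coordinates on the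
  right become \<open>p q\<^sup>2 r\<^sup>2\<close> and so on, proportional to \<open>qr : rp : pq\<close>, and so do those of \<open>Q\<close>.\<close>

lemma gen_orthocenter_eq:
  "gen_orthocenter A B C P = point (p * ((\<sigma> - q^2) * (\<sigma> - r^2)))
     (q * ((\<sigma> - r^2) * (\<sigma> - p^2))) (r * ((\<sigma> - p^2) * (\<sigma> - q^2)))"
proof (cases "\<sigma> = 0")
  case True
  have "u + v + w = 2*\<sigma>" by (simp add: uvw_defs \<sigma>_def algebra_simps)
  with True have "point u v w \<in> linf"
    using uvw_nonzero by (simp add: linf_line point_on_line_iff)
  then have "gen_orthocenter A B C P = point u v w"
    by (simp add: gen_orthocenter_def Q_eq)
  also have "\<dots> = point (- (p*q*r)*u) (- (p*q*r) * v) (- (p*q*r)*w)"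
    using off_sides by (intro point_scale[symmetric]) simp
  finally have H: "gen_orthocenter A B C P = point (- (p*q*r)*u) (- (p*q*r) * v) (- (p*q*r)*w)" .
  have uvw: "u = - (q*r)" "v = - (r*p)" "w = - (p*q)"
    using True by (simp_all add: uvw_defs \<sigma>_def algebra_simps)
  have "- (p*q*r)*u = p * ((\<sigma> - q^2) * (\<sigma> - r^2))" "- (p*q*r) * v = q * ((\<sigma> - r^2) * (\<sigma> - p^2))"
    "- (p*q*r)*w = r * ((\<sigma> - p^2) * (\<sigma> - q^2))"
    unfolding uvw True by (simp_all add: power2_eq_square algebra_simps)
  then show ?thesis by (simp only: H)
next
  case False
  have "u + v + w = 2*\<sigma>" by (simp add: uvw_defs \<sigma>_def algebra_simps)
  with False have "point u v w \<notin> linf"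
    using uvw_nonzero by (simp add: linf_line point_on_line_iff)
  then show ?thesis
    unfolding gen_orthocenter_def Let_def Q_eq DEF_eq parallels_QD_QE_QF
    using THE_concurrent_cevians[OF off_sides at_most_one_square] by simp
qed

text \<open>If one of the three factors vanishes, only one coordinate of the orthocenter survives.\<close>

lemma gen_orthocenter_not_vertex:
  assumes "gen_orthocenter A B C P \<noteq> pt A" "gen_orthocenter A B C P \<noteq> pt B"
    "gen_orthocenter A B C P \<noteq> pt C"
  shows "\<sigma> - p^2 \<noteq> 0" "\<sigma> - q^2 \<noteq> 0" "\<sigma> - r^2 \<noteq> 0"
proof -
  have vertex: "point k 0 0 = pt A" "point 0 k 0 = pt B" "point 0 0 k = pt C" if "k \<noteq> 0" for k
    using point_scale[of k 1 0 0] point_scale[of k 0 1 0] point_scale[of k 0 0 1] that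
    by (simp_all add: pt_vertices)
  show "\<sigma> - p^2 \<noteq> 0"
  proof
    assume "\<sigma> - p^2 = 0"
    then show False
      using at_most_one_square assms(1) off_sides by (simp add: gen_orthocenter_eq vertex)
  qed
  show "\<sigma> - q^2 \<noteq> 0"
  proof
    assume "\<sigma> - q^2 = 0"
    then show False
      using at_most_one_square assms(2) off_sides by (simp add: gen_orthocenter_eq vertex)
  qed
  show "\<sigma> - r^2 \<noteq> 0"
  proof
    assume "\<sigma> - r^2 = 0"
    then show False
      using at_most_one_square assms(3) off_sides by (simp add: gen_orthocenter_eq vertex)
  qed
qed

text \<open>The identity behind this is \<open>r(\<sigma> - q\<^sup>2) + q(\<sigma> - r\<^sup>2) = (q + r)(\<sigma> - qr) = p(q + r)\<^sup>2\<close>, with its cyclic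
  versions.\<close>

lemma isotomcomplement_orthocenter:
  assumes n: "\<sigma> - p^2 \<noteq> 0" "\<sigma> - q^2 \<noteq> 0" "\<sigma> - r^2 \<noteq> 0"
  shows "isotomcomplement A B C (gen_orthocenter A B C P) = point (u^2) (v^2) (w^2)"
proof -
  define e f g where "e = \<sigma> - p^2" and "f = \<sigma> - q^2" and "g = \<sigma> - r^2"
  note efg = e_def f_def g_def
  have efg_nonzero: "e \<noteq> 0" "f \<noteq> 0" "g \<noteq> 0" using n by (simp_all add: efg)
  define k where "k = 1 / (e*f*g*(p*q*r))"
  have "k \<noteq> 0" using efg_nonzero off_sides by (simp add: k_def)
  have "r*f + q*g = p*(q + r)^2" "p*g + r*e = q*(r + p)^2" "q*e + p*f = r*(p + q)^2"
    by (simp_all add: efg \<sigma>_def power2_eq_square algebra_simps)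
  then have id: "u^2 = p*(r*f + q*g)" "v^2 = q*(p*g + r*e)" "w^2 = r*(q*e + p*f)"
    by (simp_all add: uvw_defs power2_eq_square algebra_simps)
  have "isotomcomplement A B C (gen_orthocenter A B C P)
      = complement A B C (isotomic A B C (point (p*(f*g)) (q*(g*e)) (r*(e*f))))"
    unfolding isotomcomplement_def gen_orthocenter_eq efg by simp
  also have "\<dots> = complement A B C (point (1/(p*(f*g))) (1/(q*(g*e))) (1/(r*(e*f))))"
    using efg_nonzero off_sides by (subst isotomic_point) simp_all
  also have "\<dots> = point (1/(q*(g*e)) + 1/(r*(e*f))) (1/(r*(e*f)) + 1/(p*(f*g)))
      (1/(p*(f*g)) + 1/(q*(g*e)))"
    using efg_nonzero off_sides by (subst complement_point) simp_all
  also have "\<dots> = point (k * u^2) (k * v^2) (k * w^2)"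
  proof -
    have "1/(q*(g*e)) + 1/(r*(e*f)) = k * u^2" "1/(r*(e*f)) + 1/(p*(f*g)) = k * v^2"
      "1/(p*(f*g)) + 1/(q*(g*e)) = k * w^2"
      unfolding id k_def using efg_nonzero off_sides by (simp_all add: field_simps)
    then show ?thesis by simp
  qed
  also have "\<dots> = point (u^2) (v^2) (w^2)" using \<open>k \<noteq> 0\<close> by (rule point_scale)
  finally show ?thesis .
qed

end

section \<open>The isotomcomplement of the generalized orthocenter\<close>

theorem corollary2p10:
  fixes A B C :: "real^2" and P Q H :: epoint
  assumes "\<not> collinear {A, B, C}"
    and "P \<notin> sides A B C"
    and "P \<notin> anticomplementary_sides A B C"
    and "Q = Q_pt A B C P"
    and "H = gen_orthocenter A B C P"
    and "H \<noteq> pt A" and "H \<noteq> pt B" and "H \<noteq> pt C"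
  shows "gen_isogonal A B C P (pt (centroid A B C)) = bary_square A B C Q
       \<and> bary_square A B C Q = isotomcomplement A B C H"
proof -
  interpret triangle A B C by unfold_locales (rule assms(1))
  obtain p q r where n: "p \<noteq> 0 \<or> q \<noteq> 0 \<or> r \<noteq> 0" and P: "P = point p q r"
    by (rule point_exhaust)
  interpret triangle_point A B C p q r
    using assms(2,3) n
    by unfold_locales
      (auto simp: P sides_lines anticomplementary_sides_lines point_on_line_iff add.commute)
  have "bary_square A B C Q = point (u^2) (v^2) (w^2)"
    unfolding assms(4) P Q_eq using uvw_nonzero by (simp add: bary_square_point)
  moreover have "isotomcomplement A B C H = point (u^2) (v^2) (w^2)"
    using assms(6-8) unfolding assms(5) P
    by (intro isotomcomplement_orthocenter gen_orthocenter_not_vertex)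
  ultimately show ?thesis
    unfolding P gen_isogonal_centroid by simp
qed

end
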